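(* If $X$ is any Polish geodesic metric space that contains a complete geodesic, then $\mathscr{W}_2(X)$ is not $\delta$-hyperbolic (for any $\delta\geq 0$).
   Context: A Polish space is a complete separable metric space; it is geodesic if any two points are joined by a rectifiable curve whose length is the distance between them. Geodesics are always globally minimizing and parametrized proportionally to arc length; a (non-constant) geodesic is complete if it is defined for all times $t\in\mathbb{R}$. $\mathscr{W}_2(X)$ is the set of Borel probability measures $\mu$ on $X$ with $\int_X d^2(x_0,x)\,\mu(dx)<\infty$ for some (hence every) $x_0\in X$, endowed with the quadratic Wasserstein distance $d_{\mathscr W}^2(\mu_0,\mu_1)=\inf_\Pi\int_{X\times X}d^2(x,y)\,\Pi(dx\,dy)$, the infimum being over all couplings $\Pi$ of $\mu_0,\mu_1$; it is itself Polish and geodesic. A geodesic space is $\delta$-hyperbolic if in any geodesic triangle, any point of any side is at distance at most $\delta$ from one of the other two sides. *)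

theory Defs
  imports "HOL-Probability.Probability"
begin

text \<open>
  Geodesics and hyperbolicity are needed both for the space \<open>X\<close> (a type of class
  \<open>polish_space\<close>) and for its Wasserstein space (a set of measures), so they are
  stated for a carrier \<open>S\<close> with a distance function \<open>d\<close>.
\<close>

text \<open>Only meaningful for \<open>a \<le> b\<close>; lists with fewer than two points contribute \<open>0\<close>.\<close>

definition curve_length ::
    "('a \<Rightarrow> 'a \<Rightarrow> real) \<Rightarrow> (real \<Rightarrow> 'a) \<Rightarrow> real \<Rightarrow> real \<Rightarrow> ennreal" where
  "curve_length d \<gamma> a b =
     (SUP ts \<in> {ts. sorted ts \<and> set ts \<subseteq> {a..b}}.
        \<Sum>i<length ts - 1. ennreal (d (\<gamma> (ts ! i)) (\<gamma> (ts ! Suc i))))"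

definition geodesic_space :: "'a set \<Rightarrow> ('a \<Rightarrow> 'a \<Rightarrow> real) \<Rightarrow> bool" where
  "geodesic_space S d \<longleftrightarrow>
     (\<forall>x\<in>S. \<forall>y\<in>S. \<exists>\<gamma>.
        continuous_map (top_of_set {0..1}) (Metric_space.mtopology S d) \<gamma> \<and>
        \<gamma> 0 = x \<and> \<gamma> 1 = y \<and> curve_length d \<gamma> 0 1 = ennreal (d x y))"

text \<open>
  A geodesic on the interval \<open>I\<close>: parametrized proportionally to arc length (with speed
  \<open>v\<close>) and globally minimizing. Continuity is a consequence. The case \<open>v = 0\<close> (a constant
  geodesic) is allowed.
\<close>

definition geodesic_on ::
    "real set \<Rightarrow> 'a set \<Rightarrow> ('a \<Rightarrow> 'a \<Rightarrow> real) \<Rightarrow> (real \<Rightarrow> 'a) \<Rightarrow> bool" where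
  "geodesic_on I S d \<gamma> \<longleftrightarrow>
     \<gamma> ` I \<subseteq> S \<and>
     (\<exists>v\<ge>0. \<forall>s\<in>I. \<forall>t\<in>I. s \<le> t \<longrightarrow> curve_length d \<gamma> s t = ennreal (v * (t - s))) \<and>
     (\<forall>s\<in>I. \<forall>t\<in>I. s \<le> t \<longrightarrow> curve_length d \<gamma> s t = ennreal (d (\<gamma> s) (\<gamma> t)))"

definition complete_geodesic :: "'a set \<Rightarrow> ('a \<Rightarrow> 'a \<Rightarrow> real) \<Rightarrow> (real \<Rightarrow> 'a) \<Rightarrow> bool" where
  "complete_geodesic S d \<gamma> \<longleftrightarrow> geodesic_on UNIV S d \<gamma> \<and> \<not> \<gamma> constant_on UNIV"

definition geodesic_segment ::
    "'a set \<Rightarrow> ('a \<Rightarrow> 'a \<Rightarrow> real) \<Rightarrow> 'a \<Rightarrow> 'a \<Rightarrow> 'a set \<Rightarrow> bool" where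
  "geodesic_segment S d x y A \<longleftrightarrow>
     (\<exists>\<gamma>. geodesic_on {0..1} S d \<gamma> \<and> \<gamma> 0 = x \<and> \<gamma> 1 = y \<and> A = \<gamma> ` {0..1})"

definition geodesic_triangle ::
    "'a set \<Rightarrow> ('a \<Rightarrow> 'a \<Rightarrow> real) \<Rightarrow> 'a set \<Rightarrow> 'a set \<Rightarrow> 'a set \<Rightarrow> bool" where
  "geodesic_triangle S d A B C \<longleftrightarrow>
     (\<exists>x\<in>S. \<exists>y\<in>S. \<exists>z\<in>S.
        geodesic_segment S d x y A \<and> geodesic_segment S d y z B \<and> geodesic_segment S d z x C)"

definition dist_to_set :: "('a \<Rightarrow> 'a \<Rightarrow> real) \<Rightarrow> 'a \<Rightarrow> 'a set \<Rightarrow> real" where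
  "dist_to_set d p A = (INF q\<in>A. d p q)"

text \<open>
  The thin-triangles condition itself. That \<open>S\<close> is a geodesic space is deliberately not
  part of the predicate, so that its negation asserts the existence of a fat triangle.
\<close>

definition hyperbolic :: "real \<Rightarrow> 'a set \<Rightarrow> ('a \<Rightarrow> 'a \<Rightarrow> real) \<Rightarrow> bool" where
  "hyperbolic \<delta> S d \<longleftrightarrow>
     (\<forall>A B C. geodesic_triangle S d A B C \<longrightarrow>
        (\<forall>p\<in>A. dist_to_set d p B \<le> \<delta> \<or> dist_to_set d p C \<le> \<delta>) \<and>
        (\<forall>p\<in>B. dist_to_set d p C \<le> \<delta> \<or> dist_to_set d p A \<le> \<delta>) \<and>
        (\<forall>p\<in>C. dist_to_set d p A \<le> \<delta> \<or> dist_to_set d p B \<le> \<delta>))"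

definition W2 :: "'a::polish_space measure set" where
  "W2 = {\<mu>. prob_space \<mu> \<and> sets \<mu> = sets borel \<and>
           (\<exists>x0. (\<integral>\<^sup>+x. ennreal ((dist x0 x)\<^sup>2) \<partial>\<mu>) < \<infinity>)}"

text \<open>By second countability, \<open>borel\<close> on the product type is \<open>borel \<Otimes>\<^sub>M borel\<close>.\<close>

definition couplings ::
    "'a::polish_space measure \<Rightarrow> 'a measure \<Rightarrow> ('a \<times> 'a) measure set" where
  "couplings \<mu> \<nu> =
     {\<Gamma>. prob_space \<Gamma> \<and> sets \<Gamma> = sets borel \<and> distr \<Gamma> borel fst = \<mu> \<and> distr \<Gamma> borel snd = \<nu>}"

text \<open>
  For \<open>\<mu>, \<nu> \<in> W2\<close> the infimum is finite, so \<open>enn2real\<close> loses nothing there.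
\<close>

definition W2_dist :: "'a::polish_space measure \<Rightarrow> 'a measure \<Rightarrow> real" where
  "W2_dist \<mu> \<nu> =
     sqrt (enn2real (INF \<Gamma>\<in>couplings \<mu> \<nu>. \<integral>\<^sup>+p. ennreal ((dist (fst p) (snd p))\<^sup>2) \<partial>\<Gamma>))"

end

theory Submission
  imports Defs
begin

text \<open>
  The Wasserstein space of a line contains flat pieces of dimension greater than one, and a
  complete geodesic \<open>\<gamma>\<close> carries such pieces over to \<open>W2\<close>. Two equal masses sitting at
  \<open>\<gamma> a\<close> and \<open>\<gamma> b\<close> with \<open>a \<le> b\<close> form the measure \<open>two_point (\<gamma> a) (\<gamma> b)\<close>. On a line
  it is optimal to match the left mass with the left mass and the right one with the right one,
  so the squared distance from \<open>(a, b)\<close> to \<open>(c, d)\<close> is, up to a constant,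
  \<open>(a - c)\<^sup>2 + (b - d)\<^sup>2\<close>. Thus \<open>(a, b) \<mapsto> two_point (\<gamma> a) (\<gamma> b)\<close> embeds the Euclidean
  half-plane \<open>a \<le> b\<close> into \<open>W2\<close>, up to a scale factor (\<open>W2_dist_two_point\<close>).

  The embedding maps straight segments to geodesics, so every Euclidean triangle in the half-plane
  is a geodesic triangle of \<open>W2\<close>, and the half-plane contains arbitrarily large right
  isosceles triangles. The midpoint of the hypotenuse of such a triangle is as far from the two
  legs as one wishes (\<open>not_hyperbolic_if_half_plane\<close>). Only the sides chosen for the
  triangle enter the thinness condition, so no other geodesics of \<open>W2\<close> have to be known.

  The analytic core is the lower bound \<open>transport_cost_two_point_ge\<close> for every coupling. It is
  an instance of Kantorovich duality, with potentials that are affine in the parameter of \<open>\<gamma>\<close>.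
\<close>

section \<open>Geodesics of constant speed\<close>

lemma telescoping_sum_list:
  fixes ts :: "real list"
  shows "(\<Sum>i<length ts - 1. ts ! Suc i - ts ! i) = (if ts = [] then 0 else last ts - hd ts)"
proof (cases ts)
  case (Cons t us)
  then have "(\<Sum>i<length ts - 1. ts ! Suc i - ts ! i) = ts ! (length ts - 1) - ts ! 0"
    by (intro sum_lessThan_telescope)
  then show ?thesis using Cons by (simp add: last_conv_nth)
qed simp

lemma curve_length_constant_speed:
  assumes speed: "\<And>s t. \<lbrakk>a \<le> s; s \<le> t; t \<le> b\<rbrakk> \<Longrightarrow> d (\<gamma> s) (\<gamma> t) = v * (t - s)"
    and "v \<ge> 0" "a \<le> b"
  shows "curve_length d \<gamma> a b = ennreal (v * (b - a))"
  unfolding curve_length_def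
proof (intro antisym SUP_least)
  fix ts assume "ts \<in> {ts. sorted ts \<and> set ts \<subseteq> {a..b}}"
  then have ts: "sorted ts" "set ts \<subseteq> {a..b}" by auto
  have mono: "ts ! i \<le> ts ! Suc i" if "i < length ts - 1" for i
    using ts(1) that by (auto intro: sorted_nth_mono)
  have "ennreal (d (\<gamma> (ts ! i)) (\<gamma> (ts ! Suc i))) = ennreal (v * (ts ! Suc i - ts ! i))"
    if "i < length ts - 1" for i
  proof -
    have "ts ! i \<in> {a..b}" "ts ! Suc i \<in> {a..b}"
      using ts(2) that by (auto simp: subset_iff)
    then show ?thesis using speed mono[OF that] by auto
  qed
  then have "(\<Sum>i<length ts - 1. ennreal (d (\<gamma> (ts ! i)) (\<gamma> (ts ! Suc i))))
      = (\<Sum>i<length ts - 1. ennreal (v * (ts ! Suc i - ts ! i)))"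
    by simp
  also have "\<dots> = ennreal (\<Sum>i<length ts - 1. v * (ts ! Suc i - ts ! i))"
    using mono \<open>v \<ge> 0\<close> by (intro sum_ennreal) simp
  also have "\<dots> = ennreal (v * (if ts = [] then 0 else last ts - hd ts))"
    by (simp only: sum_distrib_left[symmetric] telescoping_sum_list)
  also have "\<dots> \<le> ennreal (v * (b - a))"
  proof (intro ennreal_leI mult_left_mono)
    show "(if ts = [] then 0 else last ts - hd ts) \<le> b - a"
    proof (cases "ts = []")
      case False
      then have "last ts \<in> {a..b}" "hd ts \<in> {a..b}"
        using ts(2) hd_in_set last_in_set by blast+
      then show ?thesis using False by simp
    qed (use \<open>a \<le> b\<close> in simp)
  qed fact
  finally show "(\<Sum>i<length ts - 1. ennreal (d (\<gamma> (ts ! i)) (\<gamma> (ts ! Suc i))))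
      \<le> ennreal (v * (b - a))" .
next
  show "ennreal (v * (b - a)) \<le> (SUP ts \<in> {ts. sorted ts \<and> set ts \<subseteq> {a..b}}.
      \<Sum>i<length ts - 1. ennreal (d (\<gamma> (ts ! i)) (\<gamma> (ts ! Suc i))))"
    by (rule SUP_upper2[of "[a, b]"]) (use speed[of a b] \<open>a \<le> b\<close> in simp_all)
qed

lemma geodesic_onI:
  assumes "\<gamma> ` {a..b} \<subseteq> S" "v \<ge> 0"
    and speed: "\<And>s t. \<lbrakk>a \<le> s; s \<le> t; t \<le> b\<rbrakk> \<Longrightarrow> d (\<gamma> s) (\<gamma> t) = v * (t - s)"
  shows "geodesic_on {a..b} S d \<gamma>"
proof -
  have "curve_length d \<gamma> s t = ennreal (v * (t - s))" if "a \<le> s" "s \<le> t" "t \<le> b" for s t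
    using that assms by (intro curve_length_constant_speed speed) auto
  then show ?thesis
    unfolding geodesic_on_def using assms(1,2) speed by auto
qed

text \<open>
  A complete geodesic is a copy of the real line up to scale; a speed of \<open>0\<close> would make it
  constant.
\<close>

lemma complete_geodesic_dist:
  fixes \<gamma> :: "real \<Rightarrow> 'a::metric_space"
  assumes "complete_geodesic UNIV dist \<gamma>"
  obtains v where "v > 0" "\<And>s t. dist (\<gamma> s) (\<gamma> t) = v * \<bar>s - t\<bar>"
proof -
  from assms obtain v where "v \<ge> 0"
    and len: "\<And>s t. s \<le> t \<Longrightarrow> curve_length dist \<gamma> s t = ennreal (v * (t - s))"
    and min: "\<And>s t. s \<le> t \<Longrightarrow> curve_length dist \<gamma> s t = ennreal (dist (\<gamma> s) (\<gamma> t))"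
    unfolding complete_geodesic_def geodesic_on_def by auto
  have le: "dist (\<gamma> s) (\<gamma> t) = v * (t - s)" if "s \<le> t" for s t
    using len[OF that] min[OF that] \<open>v \<ge> 0\<close> that by simp
  have abs: "dist (\<gamma> s) (\<gamma> t) = v * \<bar>s - t\<bar>" for s t
    using le[of s t] le[of t s] by (cases "s \<le> t") (auto simp: dist_commute)
  have "v \<noteq> 0"
  proof
    assume "v = 0"
    have "\<gamma> t = \<gamma> 0" for t
      using abs[of t 0] unfolding \<open>v = 0\<close> by simp
    then have "\<gamma> constant_on UNIV"
      unfolding constant_on_def by blast
    then show False
      using assms unfolding complete_geodesic_def by blast
  qed
  then have "v > 0" using \<open>v \<ge> 0\<close> by simp
  then show ?thesis using abs by (rule that)
qed

section \<open>Fat triangles from a flat half-plane\<close>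

lemma geodesic_segment_homothetic_image:
  fixes \<Phi> :: "'b::real_normed_vector \<Rightarrow> 'a"
  assumes "convex H" "\<Phi> ` H \<subseteq> S" "c \<ge> 0"
    and homothety: "\<And>p q. \<lbrakk>p \<in> H; q \<in> H\<rbrakk> \<Longrightarrow> d (\<Phi> p) (\<Phi> q) = c * dist p q"
    and "p \<in> H" "q \<in> H"
  shows "geodesic_segment S d (\<Phi> p) (\<Phi> q) (\<Phi> ` closed_segment p q)"
proof -
  define l where "l t = (1 - t) *\<^sub>R p + t *\<^sub>R q" for t
  have lH: "l t \<in> H" if "0 \<le> t" "t \<le> 1" for t
    unfolding l_def using assms that by (intro convexD) auto
  have "l s - l t = (s - t) *\<^sub>R (q - p)" for s t
    by (simp add: l_def algebra_simps)
  then have ldist: "dist (l s) (l t) = \<bar>s - t\<bar> * dist p q" for s t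
    by (simp add: dist_norm norm_minus_commute)
  have "geodesic_on {0..1} S d (\<lambda>t. \<Phi> (l t))"
  proof (rule geodesic_onI)
    show "d (\<Phi> (l s)) (\<Phi> (l t)) = (c * dist p q) * (t - s)" if "0 \<le> s" "s \<le> t" "t \<le> 1" for s t
      using that by (subst homothety) (auto simp: lH ldist)
  qed (use assms(2,3) lH in auto)
  moreover have "\<Phi> (l 0) = \<Phi> p" "\<Phi> (l 1) = \<Phi> q"
    by (simp_all add: l_def)
  moreover have "\<Phi> ` closed_segment p q = (\<lambda>t. \<Phi> (l t)) ` {0..1}"
    unfolding closed_segment_image_interval l_def image_image ..
  ultimately show ?thesis
    unfolding geodesic_segment_def by blast
qed

text \<open>
  The half-plane contains the right isosceles triangle with legs parallel to the axes and right
  angle at \<open>(- L, L)\<close>, for every \<open>L > 0\<close>. The midpoint of its hypotenuse has distance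
  \<open>L / 2\<close> from both legs, since each leg lies on a line on which one coordinate is constant.
\<close>

lemma not_hyperbolic_if_half_plane:
  fixes \<Phi> :: "real \<times> real \<Rightarrow> 'a"
  defines "H \<equiv> {p. fst p \<le> snd p}"
  assumes "\<Phi> ` H \<subseteq> S" "c > 0"
    and homothety: "\<And>p q. \<lbrakk>p \<in> H; q \<in> H\<rbrakk> \<Longrightarrow> d (\<Phi> p) (\<Phi> q) = c * dist p q"
  shows "\<not> hyperbolic \<delta> S d"
proof
  assume hyp: "hyperbolic \<delta> S d"
  \<comment> \<open>The image of the midpoint is then at distance at least \<open>c * L / 2 = \<bar>\<delta>\<bar> + 1\<close> from the
    images of the legs.\<close>
  define L where "L = 2 * (\<bar>\<delta>\<bar> + 1) / c"
  have "L > 0" using \<open>c > 0\<close> by (simp add: L_def)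
  let ?x = "(- L, 0)" and ?y = "(0, L)" and ?z = "(- L, L)" and ?m = "(- L / 2, L / 2)"
  have "convex H"
    unfolding H_def convex_def by (auto intro!: add_mono mult_left_mono)
  have vH: "?x \<in> H" "?y \<in> H" "?z \<in> H" "?m \<in> H" using \<open>L > 0\<close> by (auto simp: H_def)
  have "geodesic_segment S d (\<Phi> p) (\<Phi> q) (\<Phi> ` closed_segment p q)" if "p \<in> H" "q \<in> H" for p q
    using \<open>convex H\<close> assms(2) \<open>c > 0\<close> homothety that
    by (intro geodesic_segment_homothetic_image[where H = H and c = c]) auto
  then have tri: "geodesic_triangle S d (\<Phi> ` closed_segment ?x ?y)
      (\<Phi> ` closed_segment ?y ?z) (\<Phi> ` closed_segment ?z ?x)"
    using vH assms(2) unfolding geodesic_triangle_def by blast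
  have "?m = midpoint ?x ?y" by (simp add: midpoint_def)
  then have m: "\<Phi> ?m \<in> \<Phi> ` closed_segment ?x ?y" by (metis imageI midpoint_in_closed_segment)
  have far: "dist_to_set d (\<Phi> ?m) (\<Phi> ` closed_segment p q) > \<delta>"
    if "p \<in> H" "q \<in> H" and apart: "\<And>r. r \<in> closed_segment p q \<Longrightarrow> dist ?m r \<ge> L / 2" for p q
  proof -
    have "closed_segment p q \<subseteq> H"
      using that(1,2) \<open>convex H\<close> by (rule closed_segment_subset)
    have "\<bar>\<delta>\<bar> + 1 \<le> d (\<Phi> ?m) r" if "r \<in> \<Phi> ` closed_segment p q" for r
    proof -
      from that obtain u where u: "r = \<Phi> u" "u \<in> closed_segment p q" by auto
      have "\<bar>\<delta>\<bar> + 1 = c * (L / 2)" using \<open>c > 0\<close> by (simp add: L_def)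
      also have "\<dots> \<le> c * dist ?m u"
        using apart[OF u(2)] \<open>c > 0\<close> by (intro mult_left_mono) auto
      also have "\<dots> = d (\<Phi> ?m) r"
        using u homothety[OF vH(4), of u] \<open>closed_segment p q \<subseteq> H\<close> by auto
      finally show ?thesis .
    qed
    then have "\<bar>\<delta>\<bar> + 1 \<le> dist_to_set d (\<Phi> ?m) (\<Phi> ` closed_segment p q)"
      unfolding dist_to_set_def by (intro cINF_greatest) auto
    then show ?thesis by simp
  qed
  have "dist ?m r \<ge> L / 2" if "r \<in> closed_segment ?y ?z" for r
  proof -
    have "snd r = L" using that by (auto simp: closed_segment_def algebra_simps)
    then show ?thesis using dist_snd_le[of ?m r] \<open>L > 0\<close> by (simp add: dist_real_def)
  qed
  moreover have "dist ?m r \<ge> L / 2" if "r \<in> closed_segment ?z ?x" for r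
  proof -
    have "fst r = - L" using that by (auto simp: closed_segment_def algebra_simps)
    then show ?thesis using dist_fst_le[of ?m r] \<open>L > 0\<close> by (simp add: dist_real_def)
  qed
  ultimately show False
    using hyp tri m far vH unfolding hyperbolic_def by (meson not_le)
qed

section \<open>Measures with two equal atoms\<close>

text \<open>
  The mean of the Dirac measures at \<open>x\<close> and \<open>y\<close>, realised as the law of a fair choice between
  the two points. In this form the coupling that moves \<open>x\<close> to \<open>x'\<close> and \<open>y\<close> to \<open>y'\<close> is
  again a two-point measure, on pairs.
\<close>

definition two_point :: "'a::topological_space \<Rightarrow> 'a \<Rightarrow> 'a measure" where
  "two_point x y = distr (measure_pmf (bernoulli_pmf (1/2))) borel (\<lambda>i. if i then x else y)"

lemma sets_two_point [simp]: "sets (two_point x y) = sets borel"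
  by (simp add: two_point_def)

lemma prob_space_two_point: "prob_space (two_point x y)"
  unfolding two_point_def by (rule measure_pmf.prob_space_distr) simp

lemma integrable_two_point:
  fixes f :: "'a::topological_space \<Rightarrow> real"
  assumes "f \<in> borel_measurable borel"
  shows "integrable (two_point x y) f"
  unfolding two_point_def using assms
  by (subst integrable_distr_eq) (auto intro!: integrable_measure_pmf_finite)

lemma integral_two_point:
  fixes f :: "'a::topological_space \<Rightarrow> real"
  assumes "f \<in> borel_measurable borel"
  shows "(\<integral>z. f z \<partial>two_point x y) = (f x + f y) / 2"
  unfolding two_point_def using assms
  by (subst integral_distr) auto

lemma nn_integral_two_point:
  fixes f :: "'a::topological_space \<Rightarrow> real"
  assumes "f \<in> borel_measurable borel" "\<And>z. f z \<ge> 0"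
  shows "(\<integral>\<^sup>+z. ennreal (f z) \<partial>two_point x y) = ennreal ((f x + f y) / 2)"
  using assms
  by (simp add: nn_integral_eq_integral integrable_two_point integral_two_point)

lemma AE_two_point:
  fixes x y :: "'a::t1_space"
  shows "AE z in two_point x y. z = x \<or> z = y"
proof -
  have "{z \<in> space borel. z = x \<or> z = y} = {x, y}" by auto
  also have "\<dots> \<in> sets borel" by (intro borel_closed finite_imp_closed) auto
  finally show ?thesis unfolding two_point_def by (subst AE_distr_iff) auto
qed

lemma two_point_in_W2: "two_point x y \<in> W2"
proof -
  have "(\<integral>\<^sup>+z. ennreal ((dist x z)\<^sup>2) \<partial>two_point x y) < \<infinity>"
    by (subst nn_integral_two_point) auto
  then show ?thesis
    unfolding W2_def using prob_space_two_point by auto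
qed

lemma monotone_coupling_two_point:
  fixes x y x' y' :: "'a::polish_space"
  shows "two_point (x, x') (y, y') \<in> couplings (two_point x y) (two_point x' y')"
proof -
  have [measurable]: "fst \<in> measurable borel (borel :: 'a measure)"
    "snd \<in> measurable borel (borel :: 'a measure)"
    by (auto intro!: borel_measurable_continuous_onI continuous_intros)
  have "distr (two_point (x, x') (y, y')) borel fst = two_point x y"
    unfolding two_point_def
    by (subst distr_distr) (auto simp: o_def if_distrib[of fst] cong: if_cong)
  moreover have "distr (two_point (x, x') (y, y')) borel snd = two_point x' y'"
    unfolding two_point_def
    by (subst distr_distr) (auto simp: o_def if_distrib[of snd] cong: if_cong)
  ultimately show ?thesis
    unfolding couplings_def using prob_space_two_point by auto
qed

section \<open>Wasserstein distance along a geodesic line\<close>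

text \<open>
  The left-hand side is affine in \<open>s\<close> and in \<open>t\<close> separately, and it agrees with
  \<open>(s - t)\<^sup>2\<close> at the two matched pairs \<open>(a, c)\<close> and \<open>(b, d)\<close>. At the crossed pairs the gap
  is \<open>(b - a) * (d - c)\<close>, so the inequality says exactly that crossing does not
  pay. The affine terms vanish at the midpoints and hence average to \<open>0\<close>.
\<close>

lemma tangent_bound:
  fixes a b c d s t :: real
  assumes st: "s = a \<or> s = b" "t = c \<or> t = d" and "a \<le> b" "c \<le> d"
  shows "((a - c)\<^sup>2 + (b - d)\<^sup>2) / 2 + 2 * ((a + b) / 2 - (c + d) / 2) * (s - (a + b) / 2)
      - 2 * ((a + b) / 2 - (c + d) / 2) * (t - (c + d) / 2) \<le> (s - t)\<^sup>2"
    (is "?l s t \<le> _")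
proof -
  have "(a - c)\<^sup>2 = ?l a c" "(b - d)\<^sup>2 = ?l b d"
    by (simp_all add: field_simps power2_eq_square)
  moreover have "(a - d)\<^sup>2 = ?l a d + (b - a) * (d - c)" "(b - c)\<^sup>2 = ?l b c + (b - a) * (d - c)"
    by (simp_all add: field_simps power2_eq_square)
  moreover have "(b - a) * (d - c) \<ge> 0"
    using assms by simp
  ultimately show ?thesis using st by (smt (verit))
qed

text \<open>
  A coupling is concentrated on the four pairs of atoms, where the cost is bounded from below by
  the sum of a function of the first and a function of the second point. Integrals of such a sum
  depend on the marginals only, and here the value is the cost of the monotone matching, whatever
  the coupling.
\<close>

lemma transport_cost_two_point_ge:
  fixes \<gamma> :: "real \<Rightarrow> 'a::polish_space"
  assumes \<gamma>: "\<And>s t. dist (\<gamma> s) (\<gamma> t) = v * \<bar>s - t\<bar>"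
    and "v > 0" and ab: "a \<le> b" and cd: "c \<le> d"
    and \<Gamma>: "\<Gamma> \<in> couplings (two_point (\<gamma> a) (\<gamma> b)) (two_point (\<gamma> c) (\<gamma> d))"
  shows "ennreal (v\<^sup>2 * ((a - c)\<^sup>2 + (b - d)\<^sup>2) / 2)
      \<le> (\<integral>\<^sup>+p. ennreal ((dist (fst p) (snd p))\<^sup>2) \<partial>\<Gamma>)"
proof -
  let ?\<mu> = "two_point (\<gamma> a) (\<gamma> b)" and ?\<nu> = "two_point (\<gamma> c) (\<gamma> d)"
  interpret prob_space \<Gamma> using \<Gamma> by (simp add: couplings_def)
  have sets: "sets \<Gamma> = sets borel" and fst: "distr \<Gamma> borel fst = ?\<mu>" and snd: "distr \<Gamma> borel snd = ?\<nu>"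
    using \<Gamma> by (auto simp: couplings_def)
  have [measurable]: "fst \<in> measurable \<Gamma> borel" "snd \<in> measurable \<Gamma> borel"
    by (auto simp: measurable_cong_sets[OF sets refl]
        intro!: borel_measurable_continuous_onI continuous_intros)
  \<comment> \<open>\<open>h\<close> and \<open>k\<close> recover the parameters of the atoms. They take only two values, which makes
    them measurable and integrable without any inverse of \<open>\<gamma>\<close> on the whole space.\<close>
  define h where "h x = (if x = \<gamma> a then a else b)" for x
  define k where "k y = (if y = \<gamma> c then c else d)" for y
  have [measurable]: "h \<in> borel_measurable borel" "k \<in> borel_measurable borel"
    unfolding h_def k_def by measurable
  have h: "h (\<gamma> a) = a" "h (\<gamma> b) = b" and k: "k (\<gamma> c) = c" "k (\<gamma> d) = d"
    using \<gamma>[of a b] \<gamma>[of c d] \<open>v > 0\<close> by (auto simp: h_def k_def)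
  define m where "m = (a + b) / 2"
  define n where "n = (c + d) / 2"
  define C where "C = ((a - c)\<^sup>2 + (b - d)\<^sup>2) / 2"
  define l where "l p = v\<^sup>2 * (C + 2 * (m - n) * (h (fst p) - m) - 2 * (m - n) * (k (snd p) - n))" for p
  have inth: "integrable \<Gamma> (\<lambda>p. h (fst p))" "(\<integral>p. h (fst p) \<partial>\<Gamma>) = m"
    using integrable_two_point[of h "\<gamma> a" "\<gamma> b"] integral_two_point[of h "\<gamma> a" "\<gamma> b"]
    by (auto simp flip: fst simp: integrable_distr_eq integral_distr h m_def)
  have intk: "integrable \<Gamma> (\<lambda>p. k (snd p))" "(\<integral>p. k (snd p) \<partial>\<Gamma>) = n"
    using integrable_two_point[of k "\<gamma> c" "\<gamma> d"] integral_two_point[of k "\<gamma> c" "\<gamma> d"]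
    by (auto simp flip: snd simp: integrable_distr_eq integral_distr k n_def)
  have intl: "integrable \<Gamma> l" "(\<integral>p. l p \<partial>\<Gamma>) = v\<^sup>2 * C"
    unfolding l_def using inth intk by (auto simp: prob_space)
  have "AE x in distr \<Gamma> borel fst. x = \<gamma> a \<or> x = \<gamma> b"
    unfolding fst by (rule AE_two_point)
  then have "AE p in \<Gamma>. fst p = \<gamma> a \<or> fst p = \<gamma> b"
    by (rule AE_distrD[rotated]) measurable
  moreover have "AE y in distr \<Gamma> borel snd. y = \<gamma> c \<or> y = \<gamma> d"
    unfolding snd by (rule AE_two_point)
  then have "AE p in \<Gamma>. snd p = \<gamma> c \<or> snd p = \<gamma> d"
    by (rule AE_distrD[rotated]) measurable
  ultimately have "AE p in \<Gamma>. l p \<le> (dist (fst p) (snd p))\<^sup>2"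
  proof eventually_elim
    case (elim p)
    have "C + 2 * (m - n) * (s - m) - 2 * (m - n) * (t - n) \<le> (s - t)\<^sup>2"
      if "s = a \<or> s = b" "t = c \<or> t = d" for s t
      using that ab cd unfolding C_def m_def n_def by (rule tangent_bound)
    from this[of "h (fst p)" "k (snd p)"] elim
    have "l p \<le> v\<^sup>2 * (h (fst p) - k (snd p))\<^sup>2"
      unfolding l_def by (intro mult_left_mono) (auto simp: h k)
    also have "\<dots> = (dist (fst p) (snd p))\<^sup>2"
      using elim by (auto simp: h k \<gamma> power_mult_distrib)
    finally show ?case .
  qed
  then have "(\<integral>\<^sup>+p. ennreal (l p) \<partial>\<Gamma>) \<le> (\<integral>\<^sup>+p. ennreal ((dist (fst p) (snd p))\<^sup>2) \<partial>\<Gamma>)"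
    by (intro nn_integral_mono_AE) (auto intro: ennreal_leI)
  moreover have "ennreal (v\<^sup>2 * C) \<le> (\<integral>\<^sup>+p. ennreal (l p) \<partial>\<Gamma>)"
  proof -
    \<comment> \<open>\<open>l\<close> may be negative, and \<open>ennreal\<close> truncates there; passing to the positive part only
      increases the integral.\<close>
    have "v\<^sup>2 * C \<le> (\<integral>p. max 0 (l p) \<partial>\<Gamma>)"
      unfolding intl(2)[symmetric] using intl(1) by (intro integral_mono) auto
    also have "ennreal \<dots> = (\<integral>\<^sup>+p. ennreal (max 0 (l p)) \<partial>\<Gamma>)"
      using intl(1) by (intro nn_integral_eq_integral[symmetric]) auto
    finally show ?thesis by (simp add: ennreal_leI)
  qed
  ultimately show ?thesis by (simp add: C_def)
qed

text \<open>
  The factor \<open>1 / sqrt 2\<close> comes from the mass \<open>1 / 2\<close> of each atom.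
\<close>

lemma W2_dist_two_point:
  fixes \<gamma> :: "real \<Rightarrow> 'a::polish_space"
  assumes \<gamma>: "\<And>s t. dist (\<gamma> s) (\<gamma> t) = v * \<bar>s - t\<bar>"
    and "v > 0" "a \<le> b" "c \<le> d"
  shows "W2_dist (two_point (\<gamma> a) (\<gamma> b)) (two_point (\<gamma> c) (\<gamma> d)) = v / sqrt 2 * dist (a, b) (c, d)"
proof -
  let ?C = "v\<^sup>2 * ((a - c)\<^sup>2 + (b - d)\<^sup>2) / 2"
  let ?K = "couplings (two_point (\<gamma> a) (\<gamma> b)) (two_point (\<gamma> c) (\<gamma> d))"
  let ?\<Gamma> = "two_point (\<gamma> a, \<gamma> c) (\<gamma> b, \<gamma> d)"
  have "(\<integral>\<^sup>+p. ennreal ((dist (fst p) (snd p))\<^sup>2) \<partial>?\<Gamma>)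
      = ennreal (((v * \<bar>a - c\<bar>)\<^sup>2 + (v * \<bar>b - d\<bar>)\<^sup>2) / 2)"
    by (subst nn_integral_two_point)
       (auto simp: \<gamma> intro!: borel_measurable_continuous_onI continuous_intros)
  then have cost: "(\<integral>\<^sup>+p. ennreal ((dist (fst p) (snd p))\<^sup>2) \<partial>?\<Gamma>) = ennreal ?C"
    by (simp add: power_mult_distrib distrib_left)
  have "(INF \<Gamma>\<in>?K. \<integral>\<^sup>+p. ennreal ((dist (fst p) (snd p))\<^sup>2) \<partial>\<Gamma>) = ennreal ?C"
  proof (rule antisym)
    show "(INF \<Gamma>\<in>?K. \<integral>\<^sup>+p. ennreal ((dist (fst p) (snd p))\<^sup>2) \<partial>\<Gamma>) \<le> ennreal ?C"
      by (rule INF_lower2[OF monotone_coupling_two_point]) (simp add: cost)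
  next
    show "ennreal ?C \<le> (INF \<Gamma>\<in>?K. \<integral>\<^sup>+p. ennreal ((dist (fst p) (snd p))\<^sup>2) \<partial>\<Gamma>)"
      using assms by (intro INF_greatest transport_cost_two_point_ge)
  qed
  then have "W2_dist (two_point (\<gamma> a) (\<gamma> b)) (two_point (\<gamma> c) (\<gamma> d)) = sqrt ?C"
    by (simp add: W2_dist_def)
  also have "\<dots> = v / sqrt 2 * dist (a, b) (c, d)"
    using \<open>v > 0\<close> by (simp add: dist_Pair_Pair dist_real_def real_sqrt_divide real_sqrt_mult)
  finally show ?thesis .
qed

theorem proposition1p4:
  fixes \<delta> :: real
  assumes "geodesic_space (UNIV :: 'a::polish_space set) dist"
    and "\<exists>\<gamma>. complete_geodesic (UNIV :: 'a set) dist \<gamma>"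
    and "\<delta> \<ge> 0"
  shows "\<not> hyperbolic \<delta> (W2 :: 'a measure set) W2_dist"
proof -
  from assms(2) obtain \<gamma> :: "real \<Rightarrow> 'a" and v
    where "v > 0" and \<gamma>: "\<And>s t. dist (\<gamma> s) (\<gamma> t) = v * \<bar>s - t\<bar>"
    by (metis complete_geodesic_dist)
  define \<Phi> where "\<Phi> p = two_point (\<gamma> (fst p)) (\<gamma> (snd p))" for p
  show ?thesis
  proof (rule not_hyperbolic_if_half_plane[where \<Phi> = \<Phi> and c = "v / sqrt 2"])
    fix p q :: "real \<times> real" assume "p \<in> {p. fst p \<le> snd p}" "q \<in> {p. fst p \<le> snd p}"
    then show "W2_dist (\<Phi> p) (\<Phi> q) = v / sqrt 2 * dist p q"
      using W2_dist_two_point[OF \<gamma>, of "fst p" "snd p" "fst q" "snd q"] \<open>v > 0\<close>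
      by (simp add: \<Phi>_def)
  qed (use \<open>v > 0\<close> two_point_in_W2 in \<open>auto simp: \<Phi>_def\<close>)
qed

end
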